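(* Let $\mathbb{K}=\mathbb{R}$ or $\mathbb{C}$. The optimal multilinear Bohnenblust--Hille constants $(K_n)_{n=1}^\infty$ over $\mathbb{K}$ satisfy $$\liminf_{n\to\infty}\,(K_{n+1}-K_n)\le 0.$$
   Context: For $\mathbb{K}=\mathbb{R}$ or $\mathbb{C}$ and a positive integer $n$, $K_n$ denotes the optimal constant in the $n$-linear Bohnenblust--Hille inequality over $\mathbb{K}$, i.e. the smallest $C\in[1,\infty)$ such that $$\left(\sum_{i_1,\ldots,i_n=1}^N |U(e_{i_1},\ldots,e_{i_n})|^{\frac{2n}{n+1}}\right)^{\frac{n+1}{2n}}\le C\,\sup|U(z_1,\ldots,z_n)|$$ for all positive integers $N$ and all $n$-linear forms $U:\mathbb{K}^N\times\cdots\times\mathbb{K}^N\to\mathbb{K}$, where $(e_i)_{i=1}^N$ is the canonical basis of $\mathbb{K}^N$ and the supremum is over all $z_1,\ldots,z_n$ in the open unit ball of $\mathbb{K}^N$ with the sup norm (the open unit polydisc if $\mathbb{K}=\mathbb{C}$). Such finite constants exist (Bohnenblust--Hille theorem). *)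

theory Defs
  imports "HOL-Analysis.Analysis"
begin

text \<open>Since \<open>N\<close> and \<open>n\<close> are quantified over, \<open>\<bbbK>\<^sup>N\<close> is modelled by the sequences vanishing from
  index \<open>N\<close> on, and \<open>n\<close>-tuples of vectors by functions on \<open>{..<n}\<close> (extensional, via \<open>PiE\<close>).
  Coordinates and slots are numbered from \<open>0\<close>.\<close>

definition coord_space :: "nat \<Rightarrow> (nat \<Rightarrow> 'a::real_normed_field) set" where
  "coord_space N = {x. \<forall>i\<ge>N. x i = 0}"

definition unit_vec :: "nat \<Rightarrow> nat \<Rightarrow> 'a::real_normed_field" where
  "unit_vec i = (\<lambda>j. if j = i then 1 else 0)"

definition sup_norm :: "nat \<Rightarrow> (nat \<Rightarrow> 'a::real_normed_field) \<Rightarrow> real" where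
  "sup_norm N x = Max ((\<lambda>i. norm (x i)) ` {..<N})"

definition open_unit_ball :: "nat \<Rightarrow> (nat \<Rightarrow> 'a::real_normed_field) set" where
  "open_unit_ball N = {x \<in> coord_space N. sup_norm N x < 1}"

definition multilinear_form ::
    "nat \<Rightarrow> nat \<Rightarrow> ((nat \<Rightarrow> nat \<Rightarrow> 'a::real_normed_field) \<Rightarrow> 'a) \<Rightarrow> bool" where
  "multilinear_form n N U \<longleftrightarrow>
     (\<forall>z \<in> {..<n} \<rightarrow>\<^sub>E coord_space N. \<forall>k<n. \<forall>x \<in> coord_space N. \<forall>y \<in> coord_space N. \<forall>c.
        U (z(k := (\<lambda>i. x i + y i))) = U (z(k := x)) + U (z(k := y)) \<and>
        U (z(k := (\<lambda>i. c * x i))) = c * U (z(k := x)))"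

definition BH_inequality :: "'a::real_normed_field itself \<Rightarrow> nat \<Rightarrow> real \<Rightarrow> bool" where
  "BH_inequality _ n C \<longleftrightarrow>
     (\<forall>N>0. \<forall>U :: (nat \<Rightarrow> nat \<Rightarrow> 'a) \<Rightarrow> 'a. multilinear_form n N U \<longrightarrow>
        (\<Sum>i \<in> {..<n} \<rightarrow>\<^sub>E {..<N}.
            norm (U (\<lambda>k\<in>{..<n}. unit_vec (i k))) powr (2 * real n / (real n + 1)))
          powr ((real n + 1) / (2 * real n))
        \<le> C * (SUP z \<in> {..<n} \<rightarrow>\<^sub>E open_unit_ball N. norm (U z)))"

definition BH_const :: "'a::real_normed_field itself \<Rightarrow> nat \<Rightarrow> real" where
  "BH_const T n = (LEAST C. 1 \<le> C \<and> BH_inequality T n C)"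

end

theory Submission
  imports Defs
begin

text \<open>If the lower limit of \<open>K (n + 1) - K n\<close> were positive, \<open>K\<close> would eventually grow at least
  linearly. It therefore suffices that \<open>K n\<close> is \<open>o(n)\<close> along a subsequence, and this follows from
  \<open>K (2 ^ m) \<le> sqrt 3 ^ m\<close>, because \<open>sqrt 3 < 2\<close>. (Sharp Khinchine constants would lower \<open>sqrt 3\<close>,
  but any factor below \<open>2\<close> per doubling of the degree is enough.)

  For degree \<open>1\<close> the inequality holds with constant \<open>1\<close>: align the phases of the coordinates with
  the coefficients (\<open>BH_array_singleton\<close>). The doubling step \<open>BH_array_double\<close> takes the coefficients
  \<open>a(i, j)\<close> of a form of degree \<open>2k\<close>, where \<open>i\<close> collects the indices of the first \<open>k\<close> slots and \<open>j\<close>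
  those of the others.

  \<^item> Put random signs into the last \<open>k\<close> slots. Each choice of signs leaves a form of degree \<open>k\<close> whose
  norm is at most that of the original form, so the inequality of degree \<open>k\<close> applies to it. The
  signs are averaged out by the Khinchine inequality for the exponent \<open>p = 2k/(k+1)\<close>
  (\<open>chaos_Khinchine\<close>), which gives a bound on the mixed norm of \<open>a\<close>, \<open>\<ell>\<^sup>2\<close> in \<open>j\<close> and \<open>\<ell>\<^sup>p\<close> in \<open>i\<close>
  (\<open>mixed_norm_bound\<close>). The roles of \<open>i\<close> and \<open>j\<close> can be exchanged.

  \<^item> The two mixed norms control the norm of \<open>a\<close> for the exponent \<open>4k/(2k+1)\<close>, which is the one that
  belongs to degree \<open>2k\<close> (\<open>Blei_inequality\<close>).

  The loss is only \<open>sqrt 3\<close> because \<open>p\<close> approaches \<open>2\<close> as \<open>k\<close> grows. A sum over products of \<open>k\<close> signs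
  has fourth moment at most \<open>3 ^ k\<close> times the square of its second moment. Hoelder interpolation
  between the exponents \<open>p\<close>, \<open>2\<close>, \<open>4\<close> turns this into a bound of the \<open>L\<^sup>2\<close> norm by the \<open>L\<^sup>p\<close> norm
  with a factor \<open>(3 ^ k) powr (1 / (2 * k))\<close>, which does not depend on \<open>k\<close>.

  The fourth moment is computed with a real inner product, which induces the absolute value on
  \<open>\<real>\<close> as well as on \<open>\<complex>\<close>; so both fields are treated at once.\<close>

section \<open>Sums over index tuples\<close>

lemma sum_PiE_insert:
  assumes "x \<notin> S"
  shows "(\<Sum>f \<in> insert x S \<rightarrow>\<^sub>E A. g f) = (\<Sum>y\<in>A. \<Sum>f \<in> S \<rightarrow>\<^sub>E A. g (f(x := y)))"
proof -
  have "inj_on (\<lambda>(y, f). f(x := y)) (A \<times> (S \<rightarrow>\<^sub>E A))"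
    using inj_combinator[OF assms, of "\<lambda>_. A"] by simp
  then show ?thesis
    unfolding PiE_insert_eq sum.cartesian_product
    by (subst sum.reindex) (auto simp: o_def case_prod_unfold)
qed

lemma sum_PiE_Un:
  assumes "S \<inter> T = {}"
  shows "(\<Sum>f \<in> S \<union> T \<rightarrow>\<^sub>E A. g f) = (\<Sum>i \<in> S \<rightarrow>\<^sub>E A. \<Sum>j \<in> T \<rightarrow>\<^sub>E A. g (merge S T (i, j)))"
proof -
  have "(\<Sum>f \<in> S \<union> T \<rightarrow>\<^sub>E A. g f) = (\<Sum>p \<in> (S \<rightarrow>\<^sub>E A) \<times> (T \<rightarrow>\<^sub>E A). g (merge S T p))"
  proof (rule sum.reindex_bij_witness[where j = "\<lambda>f. (restrict f S, restrict f T)" and i = "merge S T"])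
    fix f assume f: "f \<in> S \<union> T \<rightarrow>\<^sub>E A"
    then show "merge S T (restrict f S, restrict f T) = f"
      by (auto simp: merge_def fun_eq_iff PiE_def extensional_def)
    then show "g (merge S T (restrict f S, restrict f T)) = g f" by simp
    show "(restrict f S, restrict f T) \<in> (S \<rightarrow>\<^sub>E A) \<times> (T \<rightarrow>\<^sub>E A)" using f by auto
  next
    fix p assume p: "p \<in> (S \<rightarrow>\<^sub>E A) \<times> (T \<rightarrow>\<^sub>E A)"
    obtain i j where ij: "p = (i, j)" "i \<in> S \<rightarrow>\<^sub>E A" "j \<in> T \<rightarrow>\<^sub>E A" using p by auto
    show "(restrict (merge S T p) S, restrict (merge S T p) T) = p"
      using ij assms by (simp add: PiE_restrict)
    show "merge S T p \<in> S \<union> T \<rightarrow>\<^sub>E A" using ij assms by (auto simp: merge_def PiE_def extensional_def)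
  qed
  then show ?thesis by (simp add: sum.cartesian_product case_prod_unfold)
qed

section \<open>Moments of sums over random signs\<close>

definition signs :: "'i set \<Rightarrow> ('i \<Rightarrow> real) set" where
  "signs I = (I \<rightarrow>\<^sub>E {-1, 1})"

lemma card_signs: "finite I \<Longrightarrow> card (signs I) = 2 ^ card I"
  by (simp add: signs_def card_PiE numeral_2_eq_2)

lemma sum_signs_insert:
  fixes v :: "'i \<Rightarrow> 'v::real_vector"
  assumes "x \<notin> I" "finite I"
  shows "(\<Sum>s\<in>signs (insert x I). g (\<Sum>i\<in>insert x I. s i *\<^sub>R v i))
    = (\<Sum>s\<in>signs I. g ((\<Sum>i\<in>I. s i *\<^sub>R v i) + v x) + g ((\<Sum>i\<in>I. s i *\<^sub>R v i) - v x))"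
proof -
  have *: "(\<Sum>i\<in>insert x I. (s(x := c)) i *\<^sub>R v i) = c *\<^sub>R v x + (\<Sum>i\<in>I. s i *\<^sub>R v i)" for s c
    using assms by (simp del: fun_upd_apply add: fun_upd_same) (intro sum.cong; auto)
  show ?thesis
    unfolding signs_def sum_PiE_insert[OF assms(1)] *
    by (simp add: sum.distrib add.commute)
qed

text \<open>Averages over the finite set of sign patterns are written as plain sums, with the number of
  patterns on the right-hand side; this replaces independent Rademacher variables. Adding one more
  vector pairs \<open>y + v x\<close> with \<open>y - v x\<close>, so the parallelogram law gives the induction step.\<close>

lemma rademacher_second_moment:
  fixes v :: "'i \<Rightarrow> 'v::real_inner"
  assumes "finite I"
  shows "(\<Sum>s\<in>signs I. (norm (\<Sum>i\<in>I. s i *\<^sub>R v i))\<^sup>2) = 2 ^ card I * (\<Sum>i\<in>I. (norm (v i))\<^sup>2)"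
  using assms
proof (induction I rule: finite_induct)
  case empty
  then show ?case by (simp add: signs_def)
next
  case (insert x I)
  have *: "(norm (y + v x))\<^sup>2 + (norm (y - v x))\<^sup>2 = 2 * (norm y)\<^sup>2 + 2 * (norm (v x))\<^sup>2" for y
    by (simp add: power2_norm_eq_inner inner_simps inner_commute)
  have "(\<Sum>s\<in>signs (insert x I). (norm (\<Sum>i\<in>insert x I. s i *\<^sub>R v i))\<^sup>2)
      = 2 * (\<Sum>s\<in>signs I. (norm (\<Sum>i\<in>I. s i *\<^sub>R v i))\<^sup>2) + 2 ^ card I * (2 * (norm (v x))\<^sup>2)"
    unfolding sum_signs_insert[OF insert.hyps(2,1), where g = "\<lambda>y. (norm y)\<^sup>2"] *
    using insert.hyps by (simp add: sum.distrib card_signs sum_distrib_left)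
  also have "\<dots> = 2 ^ card (insert x I) * (\<Sum>i\<in>insert x I. (norm (v i))\<^sup>2)"
    using insert by (simp add: algebra_simps)
  finally show ?case .
qed

text \<open>The constant \<open>3\<close> is that of the Gaussian fourth moment. Writing \<open>h\<close>, \<open>w\<close>, \<open>c\<close> for
  \<open>(norm y)\<^sup>2\<close>, \<open>(norm (v x))\<^sup>2\<close> and \<open>y \<bullet> v x\<close>, the two signs of \<open>v x\<close> contribute
  \<open>(h + w + 2c)\<^sup>2 + (h + w - 2c)\<^sup>2\<close>; since \<open>c\<^sup>2 \<le> w h\<close>, this is at most \<open>2h\<^sup>2 + 12wh + 2w\<^sup>2\<close>. By the
  second moment, the cross term then matches that of \<open>2 * 3 * (\<sigma> + w)\<^sup>2\<close> exactly.\<close>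

lemma rademacher_fourth_moment:
  fixes v :: "'i \<Rightarrow> 'v::real_inner"
  assumes "finite I"
  shows "(\<Sum>s\<in>signs I. norm (\<Sum>i\<in>I. s i *\<^sub>R v i) ^ 4)
    \<le> 2 ^ card I * (3 * (\<Sum>i\<in>I. (norm (v i))\<^sup>2)\<^sup>2)"
  using assms
proof (induction I rule: finite_induct)
  case empty
  then show ?case by (simp add: signs_def)
next
  case (insert x I)
  define \<sigma> where "\<sigma> = (\<Sum>i\<in>I. (norm (v i))\<^sup>2)"
  define w where "w = (norm (v x))\<^sup>2"
  define f where "f s = (\<Sum>i\<in>I. s i *\<^sub>R v i)" for s
  have *: "norm (y + v x) ^ 4 + norm (y - v x) ^ 4
      \<le> 2 * norm y ^ 4 + (12 * w * (norm y)\<^sup>2 + 2 * w\<^sup>2)" for y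
  proof -
    define h where "h = (norm y)\<^sup>2"
    define c where "c = y \<bullet> v x"
    have "norm (y + v x) ^ 4 + norm (y - v x) ^ 4 = ((norm (y + v x))\<^sup>2)\<^sup>2 + ((norm (y - v x))\<^sup>2)\<^sup>2"
      by (simp flip: power_mult)
    also have "\<dots> = (h + w + 2 * c)\<^sup>2 + (h + w - 2 * c)\<^sup>2"
      unfolding w_def h_def c_def
      by (simp add: power2_norm_eq_inner inner_simps inner_commute algebra_simps)
    also have "\<dots> = 2 * (h + w)\<^sup>2 + 8 * c\<^sup>2"
      by (simp add: power2_eq_square algebra_simps)
    also have "c\<^sup>2 \<le> w * h"
      using Cauchy_Schwarz_ineq[of y "v x"]
      by (simp add: c_def w_def h_def power2_norm_eq_inner mult.commute)
    also have "2 * (h + w)\<^sup>2 + 8 * (w * h) = 2 * h\<^sup>2 + (12 * w * h + 2 * w\<^sup>2)"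
      by (simp add: power2_eq_square algebra_simps)
    also have "h\<^sup>2 = norm y ^ 4" by (simp add: h_def flip: power_mult)
    finally show ?thesis by (simp add: h_def)
  qed
  have "(\<Sum>s\<in>signs (insert x I). norm (\<Sum>i\<in>insert x I. s i *\<^sub>R v i) ^ 4)
      = (\<Sum>s\<in>signs I. norm (f s + v x) ^ 4 + norm (f s - v x) ^ 4)"
    unfolding f_def using insert by (intro sum_signs_insert)
  also have "\<dots> \<le> (\<Sum>s\<in>signs I. 2 * norm (f s) ^ 4 + (12 * w * (norm (f s))\<^sup>2 + 2 * w\<^sup>2))"
    by (intro sum_mono *)
  also have "\<dots> = 2 * (\<Sum>s\<in>signs I. norm (f s) ^ 4)
      + (12 * w * (\<Sum>s\<in>signs I. (norm (f s))\<^sup>2) + 2 ^ card I * (2 * w\<^sup>2))"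
    using insert by (simp add: sum.distrib sum_distrib_left card_signs)
  also have "\<dots> \<le> 2 * (2 ^ card I * (3 * \<sigma>\<^sup>2)) + (12 * w * (2 ^ card I * \<sigma>) + 2 ^ card I * (6 * w\<^sup>2))"
    using insert rademacher_second_moment[of I v]
    by (intro add_mono mult_left_mono) (auto simp: f_def \<sigma>_def w_def)
  also have "\<dots> = 2 ^ card (insert x I) * (3 * (\<Sum>i\<in>insert x I. (norm (v i))\<^sup>2)\<^sup>2)"
  proof -
    have "(\<Sum>i\<in>insert x I. (norm (v i))\<^sup>2) = w + \<sigma>" using insert by (simp add: \<sigma>_def w_def)
    then show ?thesis using insert.hyps by (simp add: power2_eq_square algebra_simps)
  qed
  finally show ?case .
qed

lemma L2_set_sum_le:
  "L2_set (\<lambda>\<epsilon>. \<Sum>i\<in>I. f i \<epsilon>) A \<le> (\<Sum>i\<in>I. L2_set (f i) A)"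
proof (induction I rule: infinite_finite_induct)
  case (insert x I)
  then show ?case
    using L2_set_triangle_ineq[of "f x" "\<lambda>\<epsilon>. \<Sum>i\<in>I. f i \<epsilon>" A] by simp
qed (simp_all add: L2_set_def)

text \<open>One sign pattern for each slot in \<open>T\<close>. The slots carry independent signs, so the sums below are
  decoupled Rademacher chaoses, homogeneous of degree \<open>card T\<close>.\<close>

definition sign_family :: "'s set \<Rightarrow> 'i set \<Rightarrow> ('s \<Rightarrow> 'i \<Rightarrow> real) set" where
  "sign_family T I = (T \<rightarrow>\<^sub>E signs I)"

definition chaos :: "'s set \<Rightarrow> 'i set \<Rightarrow> (('s \<Rightarrow> 'i) \<Rightarrow> 'v::real_vector) \<Rightarrow> ('s \<Rightarrow> 'i \<Rightarrow> real) \<Rightarrow> 'v" where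
  "chaos T I v \<epsilon> = (\<Sum>j \<in> T \<rightarrow>\<^sub>E I. (\<Prod>t\<in>T. \<epsilon> t (j t)) *\<^sub>R v j)"

lemma card_sign_family:
  assumes "finite T" "finite I"
  shows "card (sign_family T I) = (2 ^ card I) ^ card T"
  using assms by (simp add: sign_family_def card_PiE card_signs)

text \<open>For fixed signs in the other slots, a chaos is an ordinary sum over the signs of one slot.
  This reduces its moments to those of Rademacher sums.\<close>

lemma chaos_insert:
  assumes "t \<notin> T" "finite T"
  shows "chaos (insert t T) I v (\<epsilon>(t := s)) = (\<Sum>i\<in>I. s i *\<^sub>R chaos T I (\<lambda>j. v (j(t := i))) \<epsilon>)"
proof -
  have "(\<Prod>u\<in>T. (\<epsilon>(t := s)) u ((j(t := i)) u)) = (\<Prod>u\<in>T. \<epsilon> u (j u))" for i j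
    using assms by (intro prod.cong) auto
  then show ?thesis
    using assms by (simp add: chaos_def sum_PiE_insert scaleR_sum_right)
qed

lemma sum_sign_family_insert:
  assumes "t \<notin> T"
  shows "(\<Sum>\<epsilon> \<in> sign_family (insert t T) I. g \<epsilon>)
    = (\<Sum>\<epsilon> \<in> sign_family T I. \<Sum>s \<in> signs I. g (\<epsilon>(t := s)))"
  unfolding sign_family_def sum_PiE_insert[OF assms] by (rule sum.swap)

lemma chaos_second_moment:
  fixes v :: "('s \<Rightarrow> 'i) \<Rightarrow> 'v::real_inner"
  assumes "finite T" "finite I"
  shows "(\<Sum>\<epsilon> \<in> sign_family T I. (norm (chaos T I v \<epsilon>))\<^sup>2)
    = card (sign_family T I) * (\<Sum>j \<in> T \<rightarrow>\<^sub>E I. (norm (v j))\<^sup>2)"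
  using assms(1)
proof (induction T arbitrary: v rule: finite_induct)
  case empty
  then show ?case by (simp add: sign_family_def chaos_def)
next
  case (insert t T)
  have "(\<Sum>\<epsilon> \<in> sign_family (insert t T) I. (norm (chaos (insert t T) I v \<epsilon>))\<^sup>2)
      = (\<Sum>\<epsilon> \<in> sign_family T I. \<Sum>i\<in>I. 2 ^ card I * (norm (chaos T I (\<lambda>j. v (j(t := i))) \<epsilon>))\<^sup>2)"
    using insert assms(2)
    by (simp add: sum_sign_family_insert chaos_insert rademacher_second_moment sum_distrib_left)
  also have "\<dots> = (\<Sum>i\<in>I. 2 ^ card I * (\<Sum>\<epsilon> \<in> sign_family T I. (norm (chaos T I (\<lambda>j. v (j(t := i))) \<epsilon>))\<^sup>2))"
    by (subst sum.swap) (simp add: sum_distrib_left)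
  also have "\<dots> = card (sign_family (insert t T) I) * (\<Sum>j \<in> insert t T \<rightarrow>\<^sub>E I. (norm (v j))\<^sup>2)"
    using insert assms(2)
    by (simp add: insert.IH sum_PiE_insert card_sign_family sum_distrib_left mult.assoc)
  finally show ?case .
qed

text \<open>Averaging over one slot first costs a factor \<open>3\<close> and leaves the square of
  \<open>\<Sum>i. (norm (w i))\<^sup>2\<close>, with \<open>w i\<close> a chaos in the remaining slots. Minkowski's inequality in \<open>L\<^sup>2\<close>
  moves the sum over \<open>i\<close> out of the norm, and the induction hypothesis applies to each \<open>w i\<close>.\<close>

lemma chaos_fourth_moment:
  fixes v :: "('s \<Rightarrow> 'i) \<Rightarrow> 'v::real_inner"
  assumes "finite T" "finite I"
  shows "(\<Sum>\<epsilon> \<in> sign_family T I. norm (chaos T I v \<epsilon>) ^ 4)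
    \<le> card (sign_family T I) * (3 ^ card T * (\<Sum>j \<in> T \<rightarrow>\<^sub>E I. (norm (v j))\<^sup>2)\<^sup>2)"
  using assms(1)
proof (induction T arbitrary: v rule: finite_induct)
  case empty
  then show ?case by (simp add: sign_family_def chaos_def)
next
  case (insert t T)
  define w where "w i \<epsilon> = chaos T I (\<lambda>j. v (j(t := i))) \<epsilon>" for i \<epsilon>
  define \<sigma> where "\<sigma> i = (\<Sum>j \<in> T \<rightarrow>\<^sub>E I. (norm (v (j(t := i))))\<^sup>2)" for i
  define c where "c = real (card (sign_family T I)) * 3 ^ card T"
  have c: "c \<ge> 0" by (simp add: c_def)
  have \<sigma>: "\<sigma> i \<ge> 0" for i by (simp add: \<sigma>_def sum_nonneg)
  have L2: "L2_set (\<lambda>\<epsilon>. (norm (w i \<epsilon>))\<^sup>2) (sign_family T I) \<le> sqrt c * \<sigma> i" for i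
  proof -
    have "L2_set (\<lambda>\<epsilon>. (norm (w i \<epsilon>))\<^sup>2) (sign_family T I)
        = sqrt (\<Sum>\<epsilon> \<in> sign_family T I. norm (w i \<epsilon>) ^ 4)"
      by (simp add: L2_set_def flip: power_mult)
    also have "\<dots> \<le> sqrt (c * (\<sigma> i)\<^sup>2)"
      unfolding w_def \<sigma>_def c_def using insert.IH by (simp add: mult.assoc)
    also have "\<dots> = sqrt c * \<sigma> i" using \<sigma> by (simp add: real_sqrt_mult)
    finally show ?thesis .
  qed
  have "(\<Sum>\<epsilon> \<in> sign_family (insert t T) I. norm (chaos (insert t T) I v \<epsilon>) ^ 4)
      = (\<Sum>\<epsilon> \<in> sign_family T I. \<Sum>s \<in> signs I. norm (\<Sum>i\<in>I. s i *\<^sub>R w i \<epsilon>) ^ 4)"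
    using insert by (simp add: sum_sign_family_insert chaos_insert w_def)
  also have "\<dots> \<le> (\<Sum>\<epsilon> \<in> sign_family T I. 2 ^ card I * (3 * (\<Sum>i\<in>I. (norm (w i \<epsilon>))\<^sup>2)\<^sup>2))"
    using assms by (intro sum_mono rademacher_fourth_moment)
  also have "\<dots> = 2 ^ card I * 3 * (L2_set (\<lambda>\<epsilon>. \<Sum>i\<in>I. (norm (w i \<epsilon>))\<^sup>2) (sign_family T I))\<^sup>2"
    by (simp add: L2_set_def sum_distrib_left sum_nonneg mult.assoc)
  also have "\<dots> \<le> 2 ^ card I * 3 * (\<Sum>i\<in>I. sqrt c * \<sigma> i)\<^sup>2"
    by (intro mult_left_mono power_mono order_trans[OF L2_set_sum_le] sum_mono L2) auto
  also have "\<dots> = 2 ^ card I * 3 * (c * (\<Sum>i\<in>I. \<sigma> i)\<^sup>2)"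
    using c by (simp add: power_mult_distrib flip: sum_distrib_left)
  also have "\<dots> = card (sign_family (insert t T) I)
      * (3 ^ card (insert t T) * (\<Sum>j \<in> insert t T \<rightarrow>\<^sub>E I. (norm (v j))\<^sup>2)\<^sup>2)"
    using insert assms(2)
    by (simp add: c_def \<sigma>_def sum_PiE_insert card_sign_family)
  finally show ?case .
qed

section \<open>Interpolation inequalities\<close>

text \<open>Hoelder's inequality with the exponents put on the summands; after division by the two sums it
  is Young's inequality term by term.\<close>

lemma Holder_inequality_sum:
  fixes x y :: "'i \<Rightarrow> real"
  assumes "0 < \<alpha>" "0 < \<beta>" "\<alpha> + \<beta> = 1"
    and x: "\<And>i. i \<in> A \<Longrightarrow> 0 \<le> x i" and y: "\<And>i. i \<in> A \<Longrightarrow> 0 \<le> y i"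
  shows "(\<Sum>i\<in>A. x i powr \<alpha> * y i powr \<beta>) \<le> (\<Sum>i\<in>A. x i) powr \<alpha> * (\<Sum>i\<in>A. y i) powr \<beta>"
proof (cases "(\<Sum>i\<in>A. x i) = 0 \<or> (\<Sum>i\<in>A. y i) = 0")
  case True
  then have "(\<Sum>i\<in>A. x i powr \<alpha> * y i powr \<beta>) = 0"
  proof (cases "finite A")
    case fin: True
    then have "(\<forall>i\<in>A. x i = 0) \<or> (\<forall>i\<in>A. y i = 0)"
      using True x y by (simp add: sum_nonneg_eq_0_iff)
    then show ?thesis by (intro sum.neutral) auto
  qed simp
  then show ?thesis by simp
next
  case False
  define X where "X = (\<Sum>i\<in>A. x i)"
  define Y where "Y = (\<Sum>i\<in>A. y i)"
  have pos: "X > 0" "Y > 0"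
    using False x y by (auto simp: X_def Y_def less_le sum_nonneg)
  have "x i powr \<alpha> * y i powr \<beta> \<le> X powr \<alpha> * Y powr \<beta> * (\<alpha> * (x i / X) + \<beta> * (y i / Y))"
    if "i \<in> A" for i
  proof (cases "x i = 0 \<or> y i = 0")
    case True
    have "0 \<le> X powr \<alpha> * Y powr \<beta> * (\<alpha> * (x i / X) + \<beta> * (y i / Y))"
      using assms(1,2) x[OF that] y[OF that] pos
      by (intro mult_nonneg_nonneg add_nonneg_nonneg divide_nonneg_nonneg) auto
    then show ?thesis using True by auto
  next
    case False
    then have "x i > 0" "y i > 0" using x[OF that] y[OF that] by auto
    then have "(x i / X) powr \<alpha> * (y i / Y) powr \<beta> \<le> \<alpha> * (x i / X) + \<beta> * (y i / Y)"
      using assms pos by (intro Youngs_inequality_0) auto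
    then show ?thesis
      using pos \<open>x i > 0\<close> \<open>y i > 0\<close> by (simp add: powr_divide field_simps)
  qed
  then have "(\<Sum>i\<in>A. x i powr \<alpha> * y i powr \<beta>)
      \<le> (\<Sum>i\<in>A. X powr \<alpha> * Y powr \<beta> * (\<alpha> * (x i / X) + \<beta> * (y i / Y)))"
    by (rule sum_mono)
  also have "\<dots> = X powr \<alpha> * Y powr \<beta> * (\<alpha> * (X / X) + \<beta> * (Y / Y))"
    by (simp add: X_def Y_def sum.distrib flip: sum_distrib_left sum_divide_distrib)
  also have "\<dots> = X powr \<alpha> * Y powr \<beta>"
    using pos assms(3) by simp
  finally show ?thesis by (simp add: X_def Y_def)
qed

lemma power_powr:
  fixes t :: real
  assumes "t \<ge> 0" "n > 0"
  shows "(t ^ n) powr a = t powr (real n * a)"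
  using assms by (cases "t = 0") (simp_all add: powr_powr flip: powr_realpow)

text \<open>For \<open>p = 2k/(k+1)\<close> one has \<open>2 = p * \<alpha> + 4 * \<beta>\<close> with \<open>\<alpha> = (k+1)/(k+2)\<close> and \<open>\<beta> = 1/(k+2)\<close>, so
  Hoelder's inequality bounds the second moment by the moments of order \<open>p\<close> and \<open>4\<close>. The fourth
  moment is at most \<open>3 ^ k\<close> times the square of the second one, which is then cancelled. The constant
  \<open>3 powr (k/(k+1))\<close> is \<open>(sqrt 3) powr p\<close>, so the \<open>L\<^sup>2\<close> norm is at most \<open>sqrt 3\<close>
  times the \<open>L\<^sup>p\<close> norm for every \<open>k\<close>: as \<open>p\<close> approaches \<open>2\<close> at the rate \<open>1/k\<close>, this offsets the growth of
  the fourth moment with \<open>k\<close>.\<close>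

lemma chaos_Khinchine:
  fixes v :: "('s \<Rightarrow> 'i) \<Rightarrow> 'v::real_inner"
  assumes "finite T" "finite I" "T \<noteq> {}"
  defines "k \<equiv> real (card T)"
  shows "card (sign_family T I) * (\<Sum>j \<in> T \<rightarrow>\<^sub>E I. (norm (v j))\<^sup>2) powr (k / (k + 1))
    \<le> 3 powr (k / (k + 1))
      * (\<Sum>\<epsilon> \<in> sign_family T I. norm (chaos T I v \<epsilon>) powr (2 * k / (k + 1)))"
proof -
  define m where "m = real (card (sign_family T I))"
  define s where "s = (\<Sum>j \<in> T \<rightarrow>\<^sub>E I. (norm (v j))\<^sup>2)"
  define p where "p = 2 * k / (k + 1)"
  define P where "P = (\<Sum>\<epsilon> \<in> sign_family T I. norm (chaos T I v \<epsilon>) powr p)"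
  define Q where "Q = (\<Sum>\<epsilon> \<in> sign_family T I. norm (chaos T I v \<epsilon>) ^ 4)"
  define d where "d = 1 / (k + 1)"
  have k: "k \<ge> 1" using assms by (simp add: k_def Suc_leI card_gt_0_iff)
  have m: "m > 0" using assms by (simp add: m_def card_sign_family)
  have s0: "s \<ge> 0" by (simp add: s_def sum_nonneg)
  have P0: "P \<ge> 0" by (simp add: P_def sum_nonneg)
  have Q0: "Q \<ge> 0" by (simp add: Q_def sum_nonneg)
  have Q: "Q \<le> m * (3 ^ card T * s\<^sup>2)"
    unfolding Q_def m_def s_def by (rule chaos_fourth_moment[OF assms(1,2)])
  have d: "0 < d" "k * d = 1 - d" "k / (k + 1) = 1 - d" using k by (auto simp: d_def field_simps)
  define \<alpha> where "\<alpha> = (k + 1) / (k + 2)"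
  define \<beta> where "\<beta> = 1 / (k + 2)"
  have ab: "0 < \<alpha>" "0 < \<beta>" "\<alpha> + \<beta> = 1" "\<alpha> * (1 + d) = 1" "\<beta> * (1 + d) = d" "p * \<alpha> + 4 * \<beta> = 2"
    using k by (simp_all add: \<alpha>_def \<beta>_def d_def p_def divide_simps)
  have pw: "t\<^sup>2 = (t powr p) powr \<alpha> * (t ^ 4) powr \<beta>" if "t \<ge> 0" for t :: real
  proof -
    have "(t powr p) powr \<alpha> * (t ^ 4) powr \<beta> = t powr (p * \<alpha> + 4 * \<beta>)"
      using that by (simp add: powr_powr power_powr powr_add)
    then show ?thesis using ab that by simp
  qed
  have "m * s = (\<Sum>\<epsilon> \<in> sign_family T I. (norm (chaos T I v \<epsilon>))\<^sup>2)"
    unfolding m_def s_def by (rule chaos_second_moment[OF assms(1,2), symmetric])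
  also have "\<dots> \<le> P powr \<alpha> * Q powr \<beta>"
    unfolding pw[OF norm_ge_zero] P_def Q_def using ab by (intro Holder_inequality_sum) auto
  also have "\<dots> \<le> P powr \<alpha> * (m * (3 ^ card T * s\<^sup>2)) powr \<beta>"
    using Q Q0 ab by (intro mult_left_mono powr_mono2) auto
  \<comment> \<open>Raising to the power \<open>1 + d = 1 / \<alpha>\<close> makes the exponent of \<open>P\<close> equal to \<open>1\<close>.\<close>
  finally have "(m * s) powr (1 + d) \<le> (P powr \<alpha> * (m * (3 ^ card T * s\<^sup>2)) powr \<beta>) powr (1 + d)"
    using d m s0 by (intro powr_mono2) auto
  also have "\<dots> = P * (m * (3 ^ card T * s\<^sup>2)) powr d"
    using m s0 P0 ab by (simp add: powr_mult powr_powr)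
  finally have main: "(m * s) powr (1 + d) \<le> P * (m * (3 ^ card T * s\<^sup>2)) powr d" .
  have "m * s powr (1 - d) \<le> 3 powr (1 - d) * P"
  proof (cases "s = 0")
    case False
    then have s: "s > 0" using s0 by simp
    have "(m * s) powr (1 + d) = (m powr d * s powr (2 * d)) * (m * s powr (1 - d))"
    proof -
      have "s powr (1 + d) = s powr (2 * d) * s powr (1 - d)" by (simp add: add.commute flip: powr_add)
      then show ?thesis using m s by (simp add: powr_mult powr_add)
    qed
    moreover have "(m * (3 ^ card T * s\<^sup>2)) powr d = (m powr d * s powr (2 * d)) * 3 powr (1 - d)"
    proof -
      have "(3 ^ card T :: real) powr d = 3 powr (1 - d)"
        using d assms by (simp add: k_def power_powr card_gt_0_iff)
      moreover have "(s\<^sup>2) powr d = s powr (2 * d)"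
        using s by (simp add: power_powr)
      ultimately show ?thesis using m s by (simp add: powr_mult)
    qed
    ultimately have "(m powr d * s powr (2 * d)) * (m * s powr (1 - d))
        \<le> (m powr d * s powr (2 * d)) * (3 powr (1 - d) * P)"
      using main by (simp add: mult_ac)
    then show ?thesis using m s by (simp add: mult_le_cancel_left_pos)
  qed (use P0 in simp)
  then show ?thesis
    using d by (simp add: m_def s_def P_def p_def)
qed

text \<open>With \<open>Y i\<close> and \<open>Z j\<close> the squared \<open>\<ell>\<^sup>2\<close> norms of the rows and columns, \<open>e = 1/(k+1)\<close> and
  \<open>u = k/(2k+1)\<close>, every entry satisfies
  \<open>b powr (4u) = (b\<^sup>2 * Y powr -e) powr u * (b\<^sup>2 * Z powr -e) powr u * ((Y * Z) powr (1 - e)) powr (1 - 2u)\<close>.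
  Summed over all \<open>i\<close> and \<open>j\<close>, the three bases give exactly the first mixed sum, the second one, and
  their product. So Hoelder's inequality for three factors, used here as two applications of the one
  for two, proves the claim. Choosing the weights in this way avoids the comparison of the two orders
  of the mixed norms by Minkowski's inequality.\<close>

lemma Blei_inequality:
  fixes b :: "'i \<Rightarrow> 'j \<Rightarrow> real"
  assumes "finite I" "finite J" "k > 0" and b: "\<And>i j. b i j \<ge> 0"
  shows "(\<Sum>i\<in>I. \<Sum>j\<in>J. b i j powr (4 * k / (2 * k + 1)))
    \<le> ((\<Sum>i\<in>I. (\<Sum>j\<in>J. (b i j)\<^sup>2) powr (k / (k + 1)))
        * (\<Sum>j\<in>J. (\<Sum>i\<in>I. (b i j)\<^sup>2) powr (k / (k + 1)))) powr ((k + 1) / (2 * k + 1))"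
proof -
  define Y where "Y i = (\<Sum>j\<in>J. (b i j)\<^sup>2)" for i
  define Z where "Z j = (\<Sum>i\<in>I. (b i j)\<^sup>2)" for j
  define e where "e = 1 / (k + 1)"
  define u where "u = k / (2 * k + 1)"
  define A where "A = (\<Sum>i\<in>I. Y i powr (1 - e))"
  define B where "B = (\<Sum>j\<in>J. Z j powr (1 - e))"
  have e: "k / (k + 1) = 1 - e" using assms(3) by (simp add: e_def field_simps)
  have u: "0 < 2 * u" "0 < 1 - 2 * u" "4 * k / (2 * k + 1) = 4 * u" "(1 - e) * (1 - 2 * u) = e * u"
    "(k + 1) / (2 * k + 1) = 1 - u"
    using assms(3) by (simp_all add: e_def u_def divide_simps)
  have Y0: "Y i \<ge> 0" for i by (simp add: Y_def sum_nonneg)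
  have Z0: "Z j \<ge> 0" for j by (simp add: Z_def sum_nonneg)
  define x where "x = (\<lambda>(i, j). (b i j)\<^sup>2 * Y i powr - e)"
  define y where "y = (\<lambda>(i, j). (b i j)\<^sup>2 * Z j powr - e)"
  define z where "z = (\<lambda>(i, j). Y i powr (1 - e) * Z j powr (1 - e))"
  have xyz0: "x p \<ge> 0" "y p \<ge> 0" "z p \<ge> 0" for p
    by (simp_all add: x_def y_def z_def case_prod_unfold)
  have pw: "b i j powr (4 * u)
      = (x (i, j) powr (1/2) * y (i, j) powr (1/2)) powr (2 * u) * z (i, j) powr (1 - 2 * u)"
    if "i \<in> I" "j \<in> J" for i j
  proof (cases "b i j = 0")
    case True
    then show ?thesis by (simp add: x_def)
  next
    case False
    then have bp: "b i j > 0" using b[of i j] by simp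
    have "Y i > 0" "Z j > 0" unfolding Y_def Z_def
      using bp that assms(1,2) by (auto intro!: sum_pos2[of _ i] sum_pos2[of _ j])
    then have YZ: "Y i powr - (e * u) * Y i powr (e * u) = 1" "Z j powr - (e * u) * Z j powr (e * u) = 1"
      by (simp_all flip: powr_add)
    have "(x (i, j) powr (1/2) * y (i, j) powr (1/2)) powr (2 * u)
        = (b i j powr (2 * u) * Y i powr - (e * u)) * (b i j powr (2 * u) * Z j powr - (e * u))"
      using bp by (simp add: x_def y_def powr_mult powr_powr power_powr)
    moreover have "z (i, j) powr (1 - 2 * u) = Y i powr (e * u) * Z j powr (e * u)"
      using u(4) by (simp add: z_def powr_mult powr_powr)
    ultimately have "(x (i, j) powr (1/2) * y (i, j) powr (1/2)) powr (2 * u) * z (i, j) powr (1 - 2 * u)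
        = (b i j powr (2 * u) * b i j powr (2 * u)) * (Y i powr - (e * u) * Y i powr (e * u))
          * (Z j powr - (e * u) * Z j powr (e * u))"
      by (simp only: mult_ac)
    then show ?thesis unfolding YZ by (simp flip: powr_add)
  qed
  have X: "(\<Sum>p\<in>I \<times> J. x p) = A"
  proof -
    have "(\<Sum>p\<in>I \<times> J. x p) = (\<Sum>i\<in>I. Y i * Y i powr - e)"
      by (simp add: x_def Y_def sum_distrib_right flip: sum.cartesian_product)
    also have "\<dots> = A"
      unfolding A_def using Y0 by (intro sum.cong) (auto simp: powr_mult_base)
    finally show ?thesis .
  qed
  have Y: "(\<Sum>p\<in>I \<times> J. y p) = B"
  proof -
    have "(\<Sum>p\<in>I \<times> J. y p) = (\<Sum>j\<in>J. Z j * Z j powr - e)"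
      unfolding y_def sum.cartesian_product[symmetric]
      by (subst sum.swap) (simp add: Z_def sum_distrib_right)
    also have "\<dots> = B"
      unfolding B_def using Z0 by (intro sum.cong) (auto simp: powr_mult_base)
    finally show ?thesis .
  qed
  have Z: "(\<Sum>p\<in>I \<times> J. z p) = A * B"
    by (simp add: z_def A_def B_def sum_product sum.cartesian_product)
  have AB: "A \<ge> 0" "B \<ge> 0" by (simp_all add: A_def B_def sum_nonneg)
  have "(\<Sum>i\<in>I. \<Sum>j\<in>J. b i j powr (4 * u))
      = (\<Sum>p\<in>I \<times> J. (x p powr (1/2) * y p powr (1/2)) powr (2 * u) * z p powr (1 - 2 * u))"
    unfolding sum.cartesian_product using pw by (intro sum.cong) auto
  also have "\<dots> \<le> (\<Sum>p\<in>I \<times> J. x p powr (1/2) * y p powr (1/2)) powr (2 * u)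
      * (\<Sum>p\<in>I \<times> J. z p) powr (1 - 2 * u)"
    using u xyz0 by (intro Holder_inequality_sum) auto
  also have "\<dots> \<le> (A powr (1/2) * B powr (1/2)) powr (2 * u) * (A * B) powr (1 - 2 * u)"
    unfolding Z unfolding X[symmetric] Y[symmetric] using u xyz0
    by (intro mult_right_mono powr_mono2 Holder_inequality_sum sum_nonneg) auto
  also have "\<dots> = (A * B) powr (1 - u)"
  proof -
    have "(A powr (1/2) * B powr (1/2)) powr (2 * u) = (A * B) powr u"
      using AB by (simp add: powr_mult powr_powr)
    then show ?thesis by (simp flip: powr_add)
  qed
  finally show ?thesis
    by (simp add: A_def B_def Y_def Z_def e u)
qed

section \<open>The inequality for coefficient arrays\<close>

text \<open>A multilinear form is represented by its coefficients on the basis vectors. The slots form an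
  arbitrary finite set: the doubling step can then split them into any two halves without
  renumbering.\<close>

definition array_form :: "'s set \<Rightarrow> nat \<Rightarrow> (('s \<Rightarrow> nat) \<Rightarrow> 'a::real_normed_field) \<Rightarrow> ('s \<Rightarrow> nat \<Rightarrow> 'a) \<Rightarrow> 'a" where
  "array_form S N a z = (\<Sum>i \<in> S \<rightarrow>\<^sub>E {..<N}. a i * (\<Prod>k\<in>S. z k (i k)))"

definition polydisc :: "'s set \<Rightarrow> nat \<Rightarrow> ('s \<Rightarrow> nat \<Rightarrow> 'a::real_normed_field) set" where
  "polydisc S N = {z. \<forall>k\<in>S. \<forall>i<N. norm (z k i) \<le> 1}"

text \<open>Both sides are raised to the exponent \<open>2n/(n+1)\<close>, and the norm of the form is replaced by an
  arbitrary upper bound \<open>M\<close> on the closed polydisc, so that neither roots nor suprema have to be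
  handled in the induction.\<close>

definition BH_array :: "'a::real_normed_field itself \<Rightarrow> 's set \<Rightarrow> real \<Rightarrow> bool" where
  "BH_array _ S C \<longleftrightarrow>
     (\<forall>N. \<forall>a :: ('s \<Rightarrow> nat) \<Rightarrow> 'a. \<forall>M. (\<forall>z \<in> polydisc S N. norm (array_form S N a z) \<le> M) \<longrightarrow>
        (\<Sum>i \<in> S \<rightarrow>\<^sub>E {..<N}. norm (a i) powr (2 * real (card S) / (real (card S) + 1)))
          \<le> (C * M) powr (2 * real (card S) / (real (card S) + 1)))"

lemma array_form_bound_nonneg:
  assumes "\<forall>z \<in> polydisc S N. norm (array_form S N a z) \<le> M"
  shows "0 \<le> M"
proof -
  have "(\<lambda>_ _. 0) \<in> polydisc S N" by (simp add: polydisc_def)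
  then show ?thesis using assms norm_ge_zero order_trans by blast
qed

lemma BH_array_singleton:
  fixes s :: 's
  shows "BH_array TYPE('a::real_normed_field) {s} 1"
  unfolding BH_array_def
proof (intro allI impI)
  fix N M and a :: "('s \<Rightarrow> nat) \<Rightarrow> 'a"
  assume M: "\<forall>z \<in> polydisc {s} N. norm (array_form {s} N a z) \<le> M"
  define c where "c n = a (\<lambda>k\<in>{s}. n)" for n
  \<comment> \<open>With these coordinates, every term of the form equals the absolute value of its coefficient.\<close>
  define z where "z k n = (if c n = 0 then 0 else of_real (norm (c n)) / c n)" for k :: 's and n
  have c: "c (i s) = a i" if "i \<in> {s} \<rightarrow>\<^sub>E {..<N}" for i
    using that unfolding c_def by (intro arg_cong[of _ _ a]) (auto simp: fun_eq_iff PiE_def extensional_def)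
  have "array_form {s} N a z = (\<Sum>i \<in> {s} \<rightarrow>\<^sub>E {..<N}. of_real (norm (a i)))"
    unfolding array_form_def by (intro sum.cong) (auto simp: z_def c)
  also have "\<dots> = of_real (\<Sum>i \<in> {s} \<rightarrow>\<^sub>E {..<N}. norm (a i))" by simp
  finally have "norm (array_form {s} N a z) = (\<Sum>i \<in> {s} \<rightarrow>\<^sub>E {..<N}. norm (a i))"
    by (simp only: norm_of_real) (simp add: sum_nonneg)
  moreover have "z \<in> polydisc {s} N" by (simp add: polydisc_def z_def norm_divide)
  ultimately have "(\<Sum>i \<in> {s} \<rightarrow>\<^sub>E {..<N}. norm (a i)) \<le> M" using M by metis
  then show "(\<Sum>i \<in> {s} \<rightarrow>\<^sub>E {..<N}. norm (a i) powr (2 * real (card {s}) / (real (card {s}) + 1)))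
      \<le> (1 * M) powr (2 * real (card {s}) / (real (card {s}) + 1))"
    using array_form_bound_nonneg[OF M] by simp
qed

text \<open>Fixing signs in the slots \<open>T\<close> leaves a form in the slots \<open>S\<close> that is still bounded by \<open>M\<close>; its
  coefficient at \<open>i\<close> is the chaos with coefficients \<open>a (merge S T (i, j))\<close>. The inequality for \<open>S\<close>
  holds for every choice of signs, hence on average, and the Khinchine inequality for each \<open>i\<close> turns
  the average into the sum of squares over \<open>j\<close>.\<close>

lemma mixed_norm_bound:
  fixes a :: "('s \<Rightarrow> nat) \<Rightarrow> 'a::{real_normed_field,real_inner}"
  assumes S: "finite S" "card S = k" and T: "finite T" "card T = k" and disj: "S \<inter> T = {}" and k: "k > 0"
    and BH: "BH_array TYPE('a) S C" and C: "C \<ge> 0"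
    and M: "\<forall>z \<in> polydisc (S \<union> T) N. norm (array_form (S \<union> T) N a z) \<le> M"
  shows "(\<Sum>i \<in> S \<rightarrow>\<^sub>E {..<N}. (\<Sum>j \<in> T \<rightarrow>\<^sub>E {..<N}. (norm (a (merge S T (i, j))))\<^sup>2) powr (real k / (real k + 1)))
    \<le> (sqrt 3 * C * M) powr (2 * real k / (real k + 1))"
proof -
  define \<Omega> where "\<Omega> = sign_family T {..<N}"
  define m where "m = real (card \<Omega>)"
  define p where "p = 2 * real k / (real k + 1)"
  define I where "I = S \<rightarrow>\<^sub>E {..<N}"
  define b where "b \<epsilon> i = chaos T {..<N} (\<lambda>j. a (merge S T (i, j))) \<epsilon>" for \<epsilon> i
  have m: "m > 0" using T by (simp add: m_def \<Omega>_def card_sign_family)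
  have M0: "M \<ge> 0" using array_form_bound_nonneg[OF M] .
  have T0: "T \<noteq> {}" using T k by auto
  have p2: "real k / (real k + 1) = p / 2" using k by (simp add: p_def field_simps)
  have slice: "(\<Sum>i\<in>I. norm (b \<epsilon> i) powr p) \<le> (C * M) powr p" if \<epsilon>: "\<epsilon> \<in> \<Omega>" for \<epsilon>
  proof -
    have "norm (array_form S N (b \<epsilon>) z) \<le> M" if z: "z \<in> polydisc S N" for z
    proof -
      define z' where "z' = merge S T (z, \<lambda>t n. of_real (\<epsilon> t n))"
      have "\<bar>\<epsilon> t n\<bar> = 1" if "t \<in> T" "n < N" for t n
      proof -
        have "\<epsilon> t n \<in> {-1, 1}" using \<epsilon> that by (auto simp: \<Omega>_def sign_family_def signs_def PiE_iff)
        then show ?thesis by auto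
      qed
      then have "z' \<in> polydisc (S \<union> T) N"
        using z disj by (auto simp: z'_def polydisc_def)
      then have "norm (array_form (S \<union> T) N a z') \<le> M" using M by blast
      moreover have "array_form (S \<union> T) N a z' = array_form S N (b \<epsilon>) z"
      proof -
        have prod: "(\<Prod>u\<in>S \<union> T. z' u (merge S T (i, j) u))
            = (\<Prod>u\<in>S. z u (i u)) * of_real (\<Prod>t\<in>T. \<epsilon> t (j t))" for i j
          using S T disj by (simp add: prod.union_disjoint z'_def cong: prod.cong)
        show ?thesis
          unfolding array_form_def sum_PiE_Un[OF disj] prod b_def chaos_def
          by (simp add: sum_distrib_left scaleR_conv_of_real mult_ac)
      qed
      ultimately show ?thesis by simp
    qed
    then show ?thesis
      using BH S unfolding BH_array_def I_def p_def by blast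
  qed
  have "m * (\<Sum>i\<in>I. (\<Sum>j \<in> T \<rightarrow>\<^sub>E {..<N}. (norm (a (merge S T (i, j))))\<^sup>2) powr (p / 2))
      \<le> (\<Sum>i\<in>I. 3 powr (p / 2) * (\<Sum>\<epsilon>\<in>\<Omega>. norm (b \<epsilon> i) powr p))"
    unfolding sum_distrib_left
  proof (rule sum_mono)
    fix i assume "i \<in> I"
    show "m * (\<Sum>j \<in> T \<rightarrow>\<^sub>E {..<N}. (norm (a (merge S T (i, j))))\<^sup>2) powr (p / 2)
        \<le> (\<Sum>\<epsilon>\<in>\<Omega>. 3 powr (p / 2) * norm (b \<epsilon> i) powr p)"
      using chaos_Khinchine[OF T(1) _ T0, of "{..<N}" "\<lambda>j. a (merge S T (i, j))"] T(2)
      unfolding p2[symmetric] by (simp add: m_def \<Omega>_def b_def p_def sum_distrib_left)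
  qed
  also have "\<dots> = 3 powr (p / 2) * (\<Sum>\<epsilon>\<in>\<Omega>. \<Sum>i\<in>I. norm (b \<epsilon> i) powr p)"
    by (subst sum.swap) (simp add: sum_distrib_left)
  also have "\<dots> \<le> 3 powr (p / 2) * (\<Sum>\<epsilon>\<in>\<Omega>. (C * M) powr p)"
    by (intro mult_left_mono sum_mono slice) auto
  also have "\<dots> = m * (sqrt 3 * C * M) powr p"
    using C M0 by (simp add: m_def powr_mult powr_half_sqrt[symmetric] powr_powr)
  finally show ?thesis
    using m unfolding p2 p_def[symmetric] by (simp add: I_def)
qed

text \<open>The mixed sums \<open>A\<close> and \<open>B\<close> are at most \<open>D powr p\<close> with \<open>p = 2k/(k+1)\<close>, and Blei's inequality
  raises \<open>A * B\<close> to the power \<open>(k+1)/(2k+1)\<close>; as \<open>2p * (k+1)/(2k+1) = 4k/(2k+1)\<close>, the constant \<open>D\<close>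
  comes out without further loss.\<close>

lemma BH_array_double:
  fixes S T :: "'s set"
  assumes S: "finite S" "card S = k" and T: "finite T" "card T = k" and disj: "S \<inter> T = {}" and k: "k > 0"
    and BH: "BH_array TYPE('a::{real_normed_field,real_inner}) S C" "BH_array TYPE('a) T C" and C: "C \<ge> 0"
  shows "BH_array TYPE('a) (S \<union> T) (sqrt 3 * C)"
  unfolding BH_array_def
proof (intro allI impI)
  fix N M and a :: "('s \<Rightarrow> nat) \<Rightarrow> 'a"
  assume M: "\<forall>z \<in> polydisc (S \<union> T) N. norm (array_form (S \<union> T) N a z) \<le> M"
  define D where "D = sqrt 3 * C * M"
  define A where "A = (\<Sum>i \<in> S \<rightarrow>\<^sub>E {..<N}. (\<Sum>j \<in> T \<rightarrow>\<^sub>E {..<N}. (norm (a (merge S T (i, j))))\<^sup>2) powr (real k / (real k + 1)))"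
  define B where "B = (\<Sum>j \<in> T \<rightarrow>\<^sub>E {..<N}. (\<Sum>i \<in> S \<rightarrow>\<^sub>E {..<N}. (norm (a (merge S T (i, j))))\<^sup>2) powr (real k / (real k + 1)))"
  have card: "card (S \<union> T) = 2 * k" using S T disj by (simp add: card_Un_disjoint)
  have AB: "0 \<le> A" "0 \<le> B" by (simp_all add: A_def B_def sum_nonneg)
  have "A \<le> D powr (2 * real k / (real k + 1))"
    unfolding A_def D_def by (rule mixed_norm_bound[OF S T disj k BH(1) C M])
  moreover have "B \<le> D powr (2 * real k / (real k + 1))"
  proof -
    have "T \<inter> S = {}" using disj by auto
    from mixed_norm_bound[OF T S this k BH(2) C, of N a M] M show ?thesis
      unfolding B_def D_def by (simp add: Un_commute merge_commute[OF disj])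
  qed
  ultimately have "A * B \<le> D powr (2 * real k / (real k + 1)) * D powr (2 * real k / (real k + 1))"
    using AB by (intro mult_mono) auto
  then have AB_le: "A * B \<le> D powr (4 * real k / (real k + 1))" by (simp flip: powr_add)
  have "(\<Sum>i \<in> S \<union> T \<rightarrow>\<^sub>E {..<N}. norm (a i) powr (4 * real k / (2 * real k + 1)))
      = (\<Sum>i \<in> S \<rightarrow>\<^sub>E {..<N}. \<Sum>j \<in> T \<rightarrow>\<^sub>E {..<N}. norm (a (merge S T (i, j))) powr (4 * real k / (2 * real k + 1)))"
    by (rule sum_PiE_Un[OF disj])
  also have "\<dots> \<le> (A * B) powr ((real k + 1) / (2 * real k + 1))"
    using Blei_inequality[of "S \<rightarrow>\<^sub>E {..<N}" "T \<rightarrow>\<^sub>E {..<N}" "real k" "\<lambda>i j. norm (a (merge S T (i, j)))"] S T k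
    by (simp add: A_def B_def finite_PiE add.commute)
  also have "\<dots> \<le> (D powr (4 * real k / (real k + 1))) powr ((real k + 1) / (2 * real k + 1))"
    using AB AB_le by (intro powr_mono2) auto
  also have "\<dots> = D powr (4 * real k / (2 * real k + 1))"
  proof -
    have "4 * real k / (real k + 1) * ((real k + 1) / (2 * real k + 1)) = 4 * real k / (2 * real k + 1)"
      by simp
    then show ?thesis by (simp add: powr_powr add.commute)
  qed
  finally show "(\<Sum>i \<in> S \<union> T \<rightarrow>\<^sub>E {..<N}. norm (a i) powr (2 * real (card (S \<union> T)) / (real (card (S \<union> T)) + 1)))
      \<le> (sqrt 3 * C * M) powr (2 * real (card (S \<union> T)) / (real (card (S \<union> T)) + 1))"
    by (simp add: card D_def)
qed

lemma BH_array_power_of_two: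
  assumes "finite S" "card S = 2 ^ m"
  shows "BH_array TYPE('a::{real_normed_field,real_inner}) S (sqrt 3 ^ m)"
  using assms
proof (induction m arbitrary: S)
  case 0
  then show ?case by (auto simp: card_1_singleton_iff BH_array_singleton)
next
  case (Suc m)
  obtain T where T: "T \<subseteq> S" "card T = 2 ^ m"
    using obtain_subset_with_card_n[of "2 ^ m" S] Suc.prems by auto
  have fin: "finite T" "finite (S - T)" using T Suc.prems finite_subset by auto
  have card: "card (S - T) = 2 ^ m" using T Suc.prems fin by (simp add: card_Diff_subset)
  have "BH_array TYPE('a) (T \<union> (S - T)) (sqrt 3 * sqrt 3 ^ m)"
    using Suc.IH[OF fin(1) T(2)] Suc.IH[OF fin(2) card]
    by (intro BH_array_double[OF fin(1) T(2) fin(2) card]) auto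
  moreover have "T \<union> (S - T) = S" using T by auto
  ultimately show ?case by simp
qed

section \<open>From coefficient arrays to multilinear forms\<close>

lemma unit_vec_coord_space [simp]: "i < N \<Longrightarrow> unit_vec i \<in> coord_space N"
  by (auto simp: coord_space_def unit_vec_def)

text \<open>Linearity in a slot concerns sums of two vectors; the expansion in the basis is therefore built up
  one coordinate at a time, through the truncations of \<open>x\<close>.\<close>

lemma multilinear_form_expand_slot:
  fixes U :: "(nat \<Rightarrow> nat \<Rightarrow> 'a::real_normed_field) \<Rightarrow> 'a"
  assumes U: "multilinear_form n N U" and z: "z \<in> {..<n} \<rightarrow>\<^sub>E coord_space N"
    and k: "k < n" and x: "x \<in> coord_space N"
  shows "U (z(k := x)) = (\<Sum>i<N. x i * U (z(k := unit_vec i)))"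
proof -
  note lin = U[unfolded multilinear_form_def, rule_format, OF z k]
  have partial: "U (z(k := (\<lambda>j. if j < l then x j else 0))) = (\<Sum>i<l. x i * U (z(k := unit_vec i)))"
    if "l \<le> N" for l
    using that
  proof (induction l)
    case 0
    show ?case using lin[OF x x, of 0] by (simp del: fun_upd_apply)
  next
    case (Suc l)
    have "(\<lambda>j. if j < l then x j else 0) \<in> coord_space N" "(\<lambda>j. x l * unit_vec l j) \<in> coord_space N"
      using Suc.prems by (auto simp: coord_space_def unit_vec_def)
    moreover have "(\<lambda>j. if j < Suc l then x j else 0)
        = (\<lambda>j. (if j < l then x j else 0) + x l * unit_vec l j)"
      by (auto simp: fun_eq_iff unit_vec_def less_Suc_eq)
    ultimately show ?case
      using lin[of "\<lambda>j. if j < l then x j else 0" "\<lambda>j. x l * unit_vec l j"]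
        lin[of "unit_vec l" "unit_vec l" "x l"] Suc by (simp del: fun_upd_apply)
  qed
  have "(\<lambda>j. if j < N then x j else 0) = x"
    using x by (auto simp: coord_space_def)
  then show ?thesis using partial[of N] by simp
qed

text \<open>The slots are expanded one after the other: in \<open>w m i\<close>, the first \<open>m\<close> of them already hold basis
  vectors and the others still hold the arguments \<open>z\<close>.\<close>

lemma multilinear_form_eq_array_form:
  fixes U :: "(nat \<Rightarrow> nat \<Rightarrow> 'a::real_normed_field) \<Rightarrow> 'a"
  assumes U: "multilinear_form n N U" and z: "z \<in> {..<n} \<rightarrow>\<^sub>E coord_space N"
  shows "U z = array_form {..<n} N (\<lambda>i. U (\<lambda>k\<in>{..<n}. unit_vec (i k))) z"
proof -
  define w where "w m i = (\<lambda>k\<in>{..<n}. if k < m then unit_vec (i k) else z k)" for m and i :: "nat \<Rightarrow> nat"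
  have partial: "U z = (\<Sum>i \<in> {..<m} \<rightarrow>\<^sub>E {..<N}. U (w m i) * (\<Prod>k<m. z k (i k)))" if "m \<le> n" for m
    using that
  proof (induction m)
    case 0
    have "w 0 i = z" for i using z by (auto simp: w_def fun_eq_iff PiE_def extensional_def)
    then show ?case by simp
  next
    case (Suc m)
    have step: "U (w m i) = (\<Sum>l<N. z m l * U (w (Suc m) (i(m := l))))"
      if i: "i \<in> {..<m} \<rightarrow>\<^sub>E {..<N}" for i
    proof -
      have next_slot: "(w m i)(m := unit_vec l) = w (Suc m) (i(m := l))" for l
        using Suc.prems by (auto simp: w_def fun_eq_iff)
      have wm: "w m i \<in> {..<n} \<rightarrow>\<^sub>E coord_space N"
        using i z Suc.prems by (auto simp: w_def PiE_iff)
      have "U (w m i) = U ((w m i)(m := z m))"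
        using Suc.prems by (intro arg_cong[of _ _ U]) (auto simp: w_def fun_eq_iff)
      also have "\<dots> = (\<Sum>l<N. z m l * U ((w m i)(m := unit_vec l)))"
      proof (rule multilinear_form_expand_slot[OF U wm])
        show "m < n" using Suc.prems by simp
        then show "z m \<in> coord_space N" using PiE_mem[OF z] by simp
      qed
      finally show ?thesis unfolding next_slot .
    qed
    have "U z = (\<Sum>i \<in> {..<m} \<rightarrow>\<^sub>E {..<N}. \<Sum>l<N. U (w (Suc m) (i(m := l))) * (z m l * (\<Prod>k<m. z k (i k))))"
      using Suc by (simp add: step sum_distrib_left mult_ac)
    also have "\<dots> = (\<Sum>i \<in> {..<Suc m} \<rightarrow>\<^sub>E {..<N}. U (w (Suc m) i) * (\<Prod>k<Suc m. z k (i k)))"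
    proof -
      have "(\<Prod>k<m. z k ((i(m := l)) k)) = (\<Prod>k<m. z k (i k))" for i :: "nat \<Rightarrow> nat" and l
        by (intro prod.cong) auto
      then show ?thesis
        unfolding lessThan_Suc
        by (subst sum_PiE_insert, simp, subst sum.swap) (simp del: fun_upd_apply add: fun_upd_same)
    qed
    finally show ?case .
  qed
  have "w n i = (\<lambda>k\<in>{..<n}. unit_vec (i k))" for i by (auto simp: w_def fun_eq_iff)
  then show ?thesis using partial[of n] by (simp add: array_form_def)
qed

lemma open_unit_ball_iff:
  assumes "N > 0"
  shows "x \<in> open_unit_ball N \<longleftrightarrow> x \<in> coord_space N \<and> (\<forall>i<N. norm (x i) < 1)"
proof -
  have "{..<N} \<noteq> {}" using assms by auto
  then show ?thesis by (auto simp: open_unit_ball_def sup_norm_def Max_less_iff)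
qed

lemma array_form_scale:
  assumes "finite S"
  shows "array_form S N a (\<lambda>k i. c * z k i) = c ^ card S * array_form S N a z"
  using assms by (simp add: array_form_def prod.distrib sum_distrib_left mult_ac)

lemma array_form_bounded:
  assumes "finite S" "z \<in> polydisc S N"
  shows "norm (array_form S N a z) \<le> (\<Sum>i \<in> S \<rightarrow>\<^sub>E {..<N}. norm (a i))"
  unfolding array_form_def
proof (rule sum_norm_le)
  fix i assume "i \<in> S \<rightarrow>\<^sub>E {..<N}"
  then have "(\<Prod>k\<in>S. norm (z k (i k))) \<le> 1"
    using assms by (intro prod_le_1) (auto simp: polydisc_def PiE_iff)
  then show "norm (a i * (\<Prod>k\<in>S. z k (i k))) \<le> norm (a i)"
    by (simp add: norm_mult prod_norm[symmetric] mult_left_le)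
qed

text \<open>The supremum runs over the open polydisc, whereas the sign vectors and phases used for coefficient
  arrays can lie on the boundary of the closed one. A point \<open>z\<close> of the closed polydisc is the limit of
  \<open>r * z\<close> as \<open>r\<close> tends to \<open>1\<close> from below, and the form scales by \<open>r ^ n\<close>. The supremum is finite
  since the form is bounded by the sum of the absolute values of its coefficients.\<close>

lemma BH_inequality_of_BH_array:
  assumes n: "n > 0" and C: "C \<ge> 0" and BH: "BH_array TYPE('a::real_normed_field) {..<n} C"
  shows "BH_inequality TYPE('a) n C"
  unfolding BH_inequality_def
proof (intro allI impI)
  fix N :: nat and U :: "(nat \<Rightarrow> nat \<Rightarrow> 'a) \<Rightarrow> 'a"
  assume N: "N > 0" and U: "multilinear_form n N U"
  define a where "a i = U (\<lambda>k\<in>{..<n}. unit_vec (i k))" for i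
  define B where "B = {..<n} \<rightarrow>\<^sub>E (open_unit_ball N :: (nat \<Rightarrow> 'a) set)"
  define M where "M = (SUP z\<in>B. norm (U z))"
  define q where "q = 2 * real n / (real n + 1)"
  have q: "q > 0" "(real n + 1) / (2 * real n) = 1 / q" using n by (auto simp: q_def)
  have UB: "U z = array_form {..<n} N a z" if "z \<in> B" for z
    unfolding a_def using that
    by (intro multilinear_form_eq_array_form[OF U]) (auto simp: B_def open_unit_ball_iff[OF N] PiE_iff)
  have "bdd_above ((\<lambda>z. norm (U z)) ` B)"
  proof (rule bdd_aboveI2)
    fix z assume z: "z \<in> B"
    then have "z \<in> polydisc {..<n} N"
      by (auto simp: B_def open_unit_ball_iff[OF N] PiE_iff polydisc_def less_imp_le)
    then show "norm (U z) \<le> (\<Sum>i \<in> {..<n} \<rightarrow>\<^sub>E {..<N}. norm (a i))"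
      unfolding UB[OF z] by (intro array_form_bounded) auto
  qed
  then have upper: "norm (U z) \<le> M" if "z \<in> B" for z
    unfolding M_def using that by (intro cSUP_upper)
  have bound: "norm (array_form {..<n} N a z) \<le> M" if z: "z \<in> polydisc {..<n} N" for z
  proof (rule tendsto_upperbound)
    show "((\<lambda>r. r ^ n * norm (array_form {..<n} N a z)) \<longlongrightarrow> norm (array_form {..<n} N a z)) (at_left (1::real))"
      by (auto intro!: tendsto_eq_intros)
    have "r ^ n * norm (array_form {..<n} N a z) \<le> M" if r: "0 < r" "r < 1" for r :: real
    proof -
      define y where "y = (\<lambda>k\<in>{..<n}. \<lambda>i. if i < N then of_real r * z k i else 0)"
      have "norm (of_real r * z k i) < 1" if "k < n" "i < N" for k i
      proof -
        have "norm (z k i) \<le> 1" using z that by (auto simp: polydisc_def)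
        then have "r * norm (z k i) \<le> r" using r by (intro mult_left_le) auto
        also note \<open>r < 1\<close>
        finally show ?thesis using r by (simp add: norm_mult)
      qed
      then have y: "y \<in> B"
        by (auto simp: B_def open_unit_ball_iff[OF N] PiE_iff y_def coord_space_def)
      have "array_form {..<n} N a y = array_form {..<n} N a (\<lambda>k i. of_real r * z k i)"
        unfolding array_form_def
        by (intro sum.cong arg_cong2[of _ _ _ _ "(*)"] prod.cong) (auto simp: y_def PiE_iff)
      also have "\<dots> = of_real r ^ n * array_form {..<n} N a z"
        by (simp add: array_form_scale)
      finally show ?thesis using upper[OF y] r by (simp add: UB[OF y] norm_mult norm_power)
    qed
    then show "\<forall>\<^sub>F r in at_left (1::real). r ^ n * norm (array_form {..<n} N a z) \<le> M"
      by (intro eventually_at_leftI[of 0]) auto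
  qed simp
  have M0: "M \<ge> 0" using bound array_form_bound_nonneg by blast
  have "(\<Sum>i \<in> {..<n} \<rightarrow>\<^sub>E {..<N}. norm (a i) powr q) \<le> (C * M) powr q"
    using BH bound unfolding BH_array_def q_def by auto
  then have "(\<Sum>i \<in> {..<n} \<rightarrow>\<^sub>E {..<N}. norm (a i) powr q) powr (1 / q) \<le> ((C * M) powr q) powr (1 / q)"
    using q by (intro powr_mono2) (auto intro: sum_nonneg)
  also have "\<dots> = C * M" using q C M0 by (simp add: powr_powr)
  finally show "(\<Sum>i \<in> {..<n} \<rightarrow>\<^sub>E {..<N}. norm (U (\<lambda>k\<in>{..<n}. unit_vec (i k))) powr (2 * real n / (real n + 1)))
      powr ((real n + 1) / (2 * real n)) \<le> C * (SUP z \<in> {..<n} \<rightarrow>\<^sub>E open_unit_ball N. norm (U z))"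
    by (simp add: a_def M_def B_def q(2) flip: q_def)
qed

text \<open>A least constant over the reals need not exist for an arbitrary condition. Here the admissible
  constants form a closed set, being given by non-strict inequalities that are linear in \<open>C\<close>; it is
  bounded below by \<open>1\<close>, so its infimum belongs to it.\<close>

lemma BH_const_le:
  assumes "1 \<le> C" "BH_inequality TYPE('a::real_normed_field) n C"
  shows "BH_const TYPE('a) n \<le> C"
proof -
  define X where "X = {C. 1 \<le> C \<and> BH_inequality TYPE('a) n C}"
  have "closed X"
    unfolding X_def BH_inequality_def
    by (intro closed_Collect_conj closed_Collect_all closed_Collect_imp closed_Collect_le open_Collect_const
        continuous_intros)
  moreover have "X \<noteq> {}" "bdd_below X" using assms by (auto simp: X_def intro: bdd_belowI[of _ 1])
  ultimately have Inf: "Inf X \<in> X" by (rule closed_contains_Inf[rotated 2])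
  have "BH_const TYPE('a) n = Inf X"
    unfolding BH_const_def using Inf \<open>bdd_below X\<close>
    by (intro Least_equality) (auto simp: X_def intro: cInf_lower)
  also have "\<dots> \<le> C" using assms \<open>bdd_below X\<close> by (intro cInf_lower) (auto simp: X_def)
  finally show ?thesis .
qed

section \<open>Increments of the optimal constants\<close>

lemma BH_const_power_of_two:
  "BH_const TYPE('a::{real_normed_field,real_inner}) (2 ^ m) \<le> sqrt 3 ^ m"
proof (rule BH_const_le)
  show "1 \<le> sqrt 3 ^ m" by (simp add: one_le_power)
  show "BH_inequality TYPE('a) (2 ^ m) (sqrt 3 ^ m)"
    by (intro BH_inequality_of_BH_array BH_array_power_of_two) auto
qed

text \<open>If the increments exceeded some \<open>e > 0\<close> from \<open>N\<close> on, then \<open>f n\<close> would be at least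
  \<open>f N + e * (n - N)\<close>; at \<open>n = 2 ^ m\<close> this contradicts \<open>f n \<le> c ^ m\<close>, as \<open>(c/2) ^ m\<close> tends to \<open>0\<close>.\<close>

lemma liminf_increments_le_0:
  fixes f :: "nat \<Rightarrow> real"
  assumes f: "\<And>m. f (2 ^ m) \<le> c ^ m" and c: "0 \<le> c" "c < 2"
  shows "liminf (\<lambda>n. ereal (f (n + 1) - f n)) \<le> 0"
proof (rule ccontr)
  assume "\<not> ?thesis"
  then have "0 < liminf (\<lambda>n. ereal (f (n + 1) - f n))" by (rule not_le_imp_less)
  then obtain e where "0 < ereal e" and liminf: "ereal e < liminf (\<lambda>n. ereal (f (n + 1) - f n))"
    using ereal_dense2 by blast
  then have e: "0 < e" by simp
  from liminf have "\<forall>\<^sub>F n in sequentially. ereal e < ereal (f (n + 1) - f n)"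
    using less_LiminfD by blast
  then obtain N where N: "\<And>n. n \<ge> N \<Longrightarrow> e < f (n + 1) - f n"
    by (auto simp: eventually_sequentially)
  have growth: "f N + e * real j \<le> f (N + j)" for j
  proof (induction j)
    case (Suc j)
    then show ?case using N[of "N + j"] by (simp add: algebra_simps)
  qed simp
  have le: "f N - e * real N + e * 2 ^ m \<le> c ^ m" if "N \<le> m" for m
  proof -
    have "N \<le> 2 ^ m" using that less_exp[of m] by linarith
    then show ?thesis using growth[of "2 ^ m - N"] f[of m] by (simp add: of_nat_diff algebra_simps)
  qed
  have "(\<lambda>m. (f N - e * real N) * (1/2) ^ m + e) \<longlonglongrightarrow> (f N - e * real N) * 0 + e"
    by (intro tendsto_intros LIMSEQ_power_zero) auto
  moreover have "(\<lambda>m. (c/2) ^ m) \<longlonglongrightarrow> 0" using c by (intro LIMSEQ_power_zero) auto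
  moreover have "(f N - e * real N) * (1/2) ^ m + e \<le> (c/2) ^ m" if "N \<le> m" for m
    using divide_right_mono[OF le[OF that], of "2 ^ m"]
    by (simp add: power_divide add_divide_distrib)
  ultimately have "(f N - e * real N) * 0 + e \<le> 0"
    by (intro LIMSEQ_le) auto
  with e show False by simp
qed

theorem corollary8p3:
  shows "liminf (\<lambda>n. ereal (BH_const TYPE(real) (n + 1) - BH_const TYPE(real) n)) \<le> 0
    \<and> liminf (\<lambda>n. ereal (BH_const TYPE(complex) (n + 1) - BH_const TYPE(complex) n)) \<le> 0"
proof -
  have "sqrt 3 < 2" by (simp add: real_less_lsqrt)
  then show ?thesis
    by (intro conjI liminf_increments_le_0[OF BH_const_power_of_two]) simp_all
qed

end
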